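(* Let $\circ$ be an alternative operation on $V=\mathbb{F}_2^s$ such that $\dim W_\circ=s-3$. Then $\dim U_\circ\in\{2,3\}$.
   Context: An alternative operation on $V$ is defined from an elementary abelian $2$-subgroup $T<\mathrm{AGL}(V,+)$ acting regularly on $V$: with $\tau_a$ the unique element of $T$ sending $0$ to $a$ (postfix notation), $a\circ b:=a\tau_b$. It is assumed that the xor-translations $x\mapsto x+a$ lie in the normaliser of $T$ in $\mathrm{Sym}(V)$. The weak key space is $W_\circ=\{k: x\circ k=x+k\ \forall x\in V\}$; the product is $a\cdot b:=a+b+a\circ b$ and the error space is $U_\circ=\{a\cdot b: a,b\in V\}$. *)

theory Defs
  imports "HOL-Analysis.Analysis" "HOL-Library.Z2"
begin

text \<open>V = F_2^s is modelled as the type bit ^ 'n with s = CARD('n).\<close>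


definition affine_group :: "((bit ^ 'n::finite) \<Rightarrow> (bit ^ 'n)) set" where
  "affine_group = {t. \<exists>M :: bit ^ 'n ^ 'n. \<exists>c. invertible M \<and> t = (\<lambda>x. M *v x + c)}"

text \<open>The xor-translation by a.\<close>
definition xtrans :: "bit ^ 'n::finite \<Rightarrow> (bit ^ 'n \<Rightarrow> bit ^ 'n)" where
  "xtrans a = (\<lambda>x. x + a)"

text \<open>T is an elementary abelian 2-subgroup of AGL(V,+), acting regularly on V,
  and normalised by all xor-translations.\<close>
definition alt_group :: "((bit ^ 'n::finite) \<Rightarrow> (bit ^ 'n)) set \<Rightarrow> bool" where
  "alt_group T \<longleftrightarrow>
     T \<subseteq> affine_group \<and>
     id \<in> T \<and>
     (\<forall>t\<in>T. \<forall>u\<in>T. t \<circ> u \<in> T) \<and>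
     (\<forall>t\<in>T. inv t \<in> T) \<and>
     (\<forall>t\<in>T. \<forall>u\<in>T. t \<circ> u = u \<circ> t) \<and>
     (\<forall>t\<in>T. t \<circ> t = id) \<and>
     (\<forall>x y. \<exists>!t. t \<in> T \<and> t x = y) \<and>
     (\<forall>a. (\<lambda>t. xtrans a \<circ> t \<circ> inv (xtrans a)) ` T = T)"

text \<open>tau_a: the unique element of T sending 0 to a.\<close>
definition tau :: "((bit ^ 'n::finite) \<Rightarrow> (bit ^ 'n)) set \<Rightarrow> bit ^ 'n \<Rightarrow> (bit ^ 'n \<Rightarrow> bit ^ 'n)" where
  "tau T a = (THE t. t \<in> T \<and> t 0 = a)"

text \<open>a \<circ> b := a tau_b (postfix notation: tau_b applied to a).\<close>
definition circ :: "((bit ^ 'n::finite) \<Rightarrow> (bit ^ 'n)) set \<Rightarrow> bit ^ 'n \<Rightarrow> bit ^ 'n \<Rightarrow> bit ^ 'n" where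
  "circ T a b = tau T b a"

definition weak_keys :: "((bit ^ 'n::finite) \<Rightarrow> (bit ^ 'n)) set \<Rightarrow> (bit ^ 'n) set" where
  "weak_keys T = {k. \<forall>x. circ T x k = x + k}"

definition dotp :: "((bit ^ 'n::finite) \<Rightarrow> (bit ^ 'n)) set \<Rightarrow> bit ^ 'n \<Rightarrow> bit ^ 'n \<Rightarrow> bit ^ 'n" where
  "dotp T a b = a + b + circ T a b"

definition error_space :: "((bit ^ 'n::finite) \<Rightarrow> (bit ^ 'n)) set \<Rightarrow> (bit ^ 'n) set" where
  "error_space T = {dotp T a b | a b. True}"

end

theory Submission
  imports Defs
begin

text \<open>
  In characteristic 2 the product \<open>a \<cdot> b = a + b + a \<circ> b\<close> is an alternating bilinear map
  \<open>V \<times> V \<rightarrow> V\<close>: \<open>\<tau>\<^sub>b\<close> is affine with \<open>\<tau>\<^sub>b 0 = b\<close>, so \<open>a \<cdot> b\<close> is linear in \<open>a\<close>;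
  commutativity of \<open>T\<close> makes it symmetric and \<open>\<tau>\<^sub>a \<circ> \<tau>\<^sub>a = id\<close> gives \<open>a \<cdot> a = 0\<close>.
  Its radical is \<open>W\<^sub>\<circ>\<close> and its values span \<open>U\<^sub>\<circ>\<close>.

  Complete a basis of a radical of codimension 3 by \<open>e\<^sub>1, e\<^sub>2, e\<^sub>3\<close>. Every value lies in the
  span of \<open>e\<^sub>1 \<cdot> e\<^sub>2, e\<^sub>1 \<cdot> e\<^sub>3, e\<^sub>2 \<cdot> e\<^sub>3\<close>, so the dimension is at most 3. If all values were
  multiples \<open>e\<^sub>i \<cdot> e\<^sub>j = l\<^sub>i\<^sub>j u\<close> of one vector, then \<open>l\<^sub>2\<^sub>3 e\<^sub>1 - l\<^sub>1\<^sub>3 e\<^sub>2 + l\<^sub>1\<^sub>2 e\<^sub>3\<close>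
  would lie in the radical, forcing all \<open>l\<^sub>i\<^sub>j = 0\<close>; but then \<open>e\<^sub>1\<close> itself lies in the radical.
  Hence the dimension is at least 2.
\<close>

definition alternating_bilinear :: "('a::field ^ 'n \<Rightarrow> 'a ^ 'n \<Rightarrow> 'a ^ 'm) \<Rightarrow> bool" where
  "alternating_bilinear \<beta> \<longleftrightarrow>
     (\<forall>y. Vector_Spaces.linear (*s) (*s) (\<lambda>x. \<beta> x y)) \<and>
     (\<forall>x. Vector_Spaces.linear (*s) (*s) (\<beta> x)) \<and>
     (\<forall>x. \<beta> x x = 0)"

definition bilinear_radical :: "('a::field ^ 'n \<Rightarrow> 'a ^ 'n \<Rightarrow> 'a ^ 'm) \<Rightarrow> ('a ^ 'n) set" where
  "bilinear_radical \<beta> = {k. \<forall>x. \<beta> x k = 0}"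

lemma alternating_bilinearD:
  assumes "alternating_bilinear \<beta>"
  shows alternating_bilinear_linear_left: "Vector_Spaces.linear (*s) (*s) (\<lambda>x. \<beta> x y)"
    and alternating_bilinear_linear_right: "Vector_Spaces.linear (*s) (*s) (\<beta> x)"
    and alternating_bilinear_self: "\<beta> x x = 0"
  using assms unfolding alternating_bilinear_def by blast+

lemma alternating_bilinear_skew:
  assumes "alternating_bilinear \<beta>"
  shows "\<beta> x y = - \<beta> y x"
proof -
  note lin = alternating_bilinearD[OF assms]
  have "0 = \<beta> (x + y) (x + y)" using lin(3) by simp
  also have "\<dots> = \<beta> x x + \<beta> x y + (\<beta> y x + \<beta> y y)"
    by (simp add: vec.linear_add[OF lin(1)] vec.linear_add[OF lin(2)])
  finally have "\<beta> x y + \<beta> y x = 0" using lin(3) by simp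
  then show ?thesis by (simp add: eq_neg_iff_add_eq_0)
qed

lemma subspace_bilinear_radical:
  assumes "alternating_bilinear \<beta>"
  shows "vec.subspace (bilinear_radical \<beta>)"
  unfolding bilinear_radical_def vec.subspace_def
  by (simp add: vec.linear_0 vec.linear_add vec.linear_scale alternating_bilinearD[OF assms])

lemma alternating_bilinear_in_span_basis_values:
  assumes "alternating_bilinear \<beta>" and "vec.span B = UNIV"
  shows "\<beta> x y \<in> vec.span {\<beta> s t | s t. s \<in> B \<and> t \<in> B}"
proof -
  let ?S = "vec.span {\<beta> s t | s t. s \<in> B \<and> t \<in> B}"
  have "(\<lambda>x. \<beta> x t) ` UNIV \<subseteq> vec.span ((\<lambda>x. \<beta> x t) ` B)" for t
    using vec.linear_spans_image[OF alternating_bilinear_linear_left[OF assms(1)]] assms(2) by blast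
  moreover have "vec.span ((\<lambda>x. \<beta> x t) ` B) \<subseteq> ?S" if "t \<in> B" for t
    using that by (intro vec.span_mono) blast
  ultimately have left: "\<beta> x t \<in> ?S" if "t \<in> B" for x t
    using that by blast
  have "\<beta> x ` UNIV \<subseteq> vec.span (\<beta> x ` B)"
    using vec.linear_spans_image[OF alternating_bilinear_linear_right[OF assms(1)]] assms(2) by blast
  also have "\<dots> \<subseteq> ?S"
    using left by (intro vec.span_minimal) auto
  finally show ?thesis by blast
qed

lemma in_bilinear_radical_if_vanishes_on_spanning_set:
  assumes "alternating_bilinear \<beta>" and "vec.span B = UNIV"
    and "\<And>s. s \<in> B \<Longrightarrow> \<beta> s k = 0"
  shows "k \<in> bilinear_radical \<beta>"
  unfolding bilinear_radical_def
  using vec.linear_eq_0_on_span[OF alternating_bilinear_linear_left[OF assms(1)]] assms(2,3) by blast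

lemma coefficient_zero_if_in_span_of_rest:
  assumes "vec.independent B" and "e \<in> B"
    and "c *s e + y \<in> vec.span (B - {e})" and "y \<in> vec.span (B - {e})"
  shows "c = 0"
proof (rule ccontr)
  assume "c \<noteq> 0"
  have "c *s e \<in> vec.span (B - {e})"
    using vec.span_diff[OF assms(3,4)] by simp
  then have "inverse c *s (c *s e) \<in> vec.span (B - {e})"
    by (rule vec.span_scale)
  then have "e \<in> vec.span (B - {e})"
    using \<open>c \<noteq> 0\<close> by simp
  then show False
    using assms(1,2) vec.dependent_def by blast
qed

locale radical_complement_3 =
  fixes \<beta> :: "'a::field ^ 'n \<Rightarrow> 'a ^ 'n \<Rightarrow> 'a ^ 'm"
    and R :: "('a ^ 'n) set" and e1 e2 e3 :: "'a ^ 'n"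
  assumes alternating_bilinear: "alternating_bilinear \<beta>"
    and independent: "vec.independent (R \<union> {e1, e2, e3})"
    and spanning: "vec.span (R \<union> {e1, e2, e3}) = UNIV"
    and span_radical: "vec.span R = bilinear_radical \<beta>"
    and distinct: "distinct [e1, e2, e3]"
    and disjoint: "{e1, e2, e3} \<inter> R = {}"
begin

lemma radical_vanishes:
  assumes "r \<in> R"
  shows "\<beta> x r = 0" and "\<beta> r x = 0"
  using assms vec.span_base[of r R] span_radical
    alternating_bilinear_skew[OF alternating_bilinear, of r x]
  by (auto simp: bilinear_radical_def)

lemma dim_values_le_3: "vec.dim {\<beta> a b | a b. True} \<le> 3"
proof -
  let ?E = "{\<beta> e1 e2, \<beta> e1 e3, \<beta> e2 e3}"
  have "\<beta> s t \<in> vec.span ?E" if "s \<in> R \<union> {e1, e2, e3}" "t \<in> R \<union> {e1, e2, e3}" for s t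
  proof -
    have "\<beta> s t \<in> {0} \<union> ?E \<union> uminus ` ?E"
      using that radical_vanishes alternating_bilinear_self[OF alternating_bilinear]
        alternating_bilinear_skew[OF alternating_bilinear, of s t]
      by fast
    then show ?thesis
      by (auto simp: vec.span_neg vec.span_base vec.span_zero)
  qed
  then have "vec.span {\<beta> s t | s t. s \<in> R \<union> {e1, e2, e3} \<and> t \<in> R \<union> {e1, e2, e3}}
      \<subseteq> vec.span ?E"
    by (intro vec.span_minimal vec.subspace_span) blast
  then have "{\<beta> a b | a b. True} \<subseteq> vec.span ?E"
    using alternating_bilinear_in_span_basis_values[OF alternating_bilinear spanning] by blast
  then have "vec.dim {\<beta> a b | a b. True} \<le> card ?E"
    by (rule vec.dim_le_card) simp
  also have "card ?E \<le> 3"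
    by (rule card_insert_le_m1) (auto intro: card_insert_le_m1)
  finally show ?thesis .
qed

lemma complement_coefficient_zero:
  assumes "{e, f, g} = {e1, e2, e3}" and "e \<notin> {f, g}"
    and "c *s e + (p *s f + q *s g) \<in> bilinear_radical \<beta>"
  shows "c = 0"
proof (rule coefficient_zero_if_in_span_of_rest[OF independent])
  show "e \<in> R \<union> {e1, e2, e3}" using assms(1) by blast
  have "vec.span R \<subseteq> vec.span (R \<union> {e1, e2, e3} - {e})"
    using assms(1) disjoint by (intro vec.span_mono) blast
  then show "c *s e + (p *s f + q *s g) \<in> vec.span (R \<union> {e1, e2, e3} - {e})"
    using assms(3) span_radical by blast
  show "p *s f + q *s g \<in> vec.span (R \<union> {e1, e2, e3} - {e})"
    using assms(1,2) by (intro vec.span_add vec.span_scale vec.span_base) blast+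
qed

lemma complement_meets_radical_trivially:
  assumes "a *s e1 + b *s e2 + c *s e3 \<in> bilinear_radical \<beta>"
  shows "a = 0" and "b = 0" and "c = 0"
  using complement_coefficient_zero[of e1 e2 e3 a b c] complement_coefficient_zero[of e2 e1 e3 b a c]
    complement_coefficient_zero[of e3 e1 e2 c a b] assms distinct
  by (auto simp: insert_commute add_ac)

lemma values_not_in_span_singleton: "\<not> {\<beta> a b | a b. True} \<subseteq> vec.span {u}"
proof
  assume collinear: "{\<beta> a b | a b. True} \<subseteq> vec.span {u}"
  have "\<beta> a b \<in> range (\<lambda>k. k *s u)" for a b
    using collinear unfolding vec.span_singleton by blast
  then obtain l12 l13 l23
    where l: "\<beta> e1 e2 = l12 *s u" "\<beta> e1 e3 = l13 *s u" "\<beta> e2 e3 = l23 *s u"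
    by (metis rangeE)
  note linear_right = alternating_bilinear_linear_right[OF alternating_bilinear]
  note self = alternating_bilinear_self[OF alternating_bilinear]
  note skew = alternating_bilinear_skew[OF alternating_bilinear]
  define v where "v = l23 *s e1 + (- l13) *s e2 + l12 *s e3"
  have "\<beta> e v = 0" if e: "e \<in> {e1, e2, e3}" for e
  proof -
    have expand: "\<beta> e v = l23 *s \<beta> e e1 + (- l13) *s \<beta> e e2 + l12 *s \<beta> e e3"
      unfolding v_def
      by (simp add: vec.linear_add[OF linear_right] vec.linear_diff[OF linear_right]
          vec.linear_scale[OF linear_right])
    consider "e = e1" | "e = e2" | "e = e3"
      using e by blast
    then show ?thesis
      unfolding expand
      by cases (simp_all add: l self skew[of e2 e1] skew[of e3 e1] skew[of e3 e2]
          vec.scale_minus_right vec.scale_scale mult.commute)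
  qed
  then have "v \<in> bilinear_radical \<beta>"
    using radical_vanishes(2)
    by (intro in_bilinear_radical_if_vanishes_on_spanning_set[OF alternating_bilinear spanning]) blast
  then have "l23 = 0" "l13 = 0" "l12 = 0"
    unfolding v_def using complement_meets_radical_trivially[of l23 "- l13" l12] by auto
  then have "\<beta> s e1 = 0" if "s \<in> {e1, e2, e3}" for s
    using that by (auto simp: l self skew[of e2 e1] skew[of e3 e1])
  then have "e1 \<in> bilinear_radical \<beta>"
    using radical_vanishes(2)
    by (intro in_bilinear_radical_if_vanishes_on_spanning_set[OF alternating_bilinear spanning]) blast
  then show False
    using complement_meets_radical_trivially(1)[of 1 0 0] by simp
qed

end

lemma radical_complement_3_exists:
  fixes \<beta> :: "'a::field ^ 'n \<Rightarrow> 'a ^ 'n \<Rightarrow> 'a ^ 'm"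
  assumes "alternating_bilinear \<beta>" and "vec.dim (bilinear_radical \<beta>) + 3 = CARD('n)"
  obtains R e1 e2 e3 where "radical_complement_3 \<beta> R e1 e2 e3"
proof -
  obtain R where R: "R \<subseteq> bilinear_radical \<beta>" "vec.independent R"
    "bilinear_radical \<beta> \<subseteq> vec.span R" "card R = vec.dim (bilinear_radical \<beta>)"
    by (rule vec.basis_exists)
  have span_R: "vec.span R = bilinear_radical \<beta>"
    using vec.span_minimal[OF R(1) subspace_bilinear_radical[OF assms(1)]] R(3) by (rule equalityI)
  obtain B where B: "R \<subseteq> B" "vec.independent B" "UNIV \<subseteq> vec.span B"
    by (rule vec.maximal_independent_subset_extend[of R UNIV]) (use R(2) in auto)
  have "finite B"
    using B(2) vec.finiteI_independent by blast
  have "card B = vec.dim (UNIV :: ('a ^ 'n) set)"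
    using B(2,3) by (intro vec.dim_eq_card[symmetric]) auto
  then have "card B = CARD('n)"
    by (simp add: card_cart_basis)
  then have "card (B - R) = 3"
    using assms(2) R(4) B(1) \<open>finite B\<close> by (simp add: card_Diff_subset finite_subset)
  then obtain e1 e2 e3 where e: "B - R = {e1, e2, e3}" "e1 \<noteq> e2" "e1 \<noteq> e3" "e2 \<noteq> e3"
    unfolding card_3_iff by blast
  then have "B = R \<union> {e1, e2, e3}"
    using B(1) by blast
  then have "radical_complement_3 \<beta> R e1 e2 e3"
    using assms(1) B(2,3) span_R e by unfold_locales auto
  then show thesis ..
qed

lemma in_span_singleton_if_dim_le_1:
  assumes "vec.dim S \<le> 1"
  obtains u :: "'a::field ^ 'n" where "S \<subseteq> vec.span {u}"
proof -
  obtain B where B: "vec.independent B" "S \<subseteq> vec.span B" "card B = vec.dim S"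
    by (metis vec.basis_exists)
  then have "finite B"
    using vec.finiteI_independent by blast
  have "card B \<le> Suc 0"
    using assms B(3) by simp
  obtain u where "B \<subseteq> {u}"
  proof (cases "B = {}")
    case True
    then show thesis using that[of 0] by simp
  next
    case False
    then obtain u where "u \<in> B" by blast
    then show thesis
      using that[of u] card_le_Suc0_iff_eq[OF \<open>finite B\<close>] \<open>card B \<le> Suc 0\<close> by blast
  qed
  then show thesis
    using B(2) vec.span_mono[of B "{u}"] that by blast
qed

theorem dim_values_if_radical_codim_3:
  fixes \<beta> :: "'a::field ^ 'n \<Rightarrow> 'a ^ 'n \<Rightarrow> 'a ^ 'm"
  assumes "alternating_bilinear \<beta>" and "vec.dim (bilinear_radical \<beta>) + 3 = CARD('n)"
  shows "vec.dim {\<beta> a b | a b. True} \<in> {2, 3}"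
proof -
  obtain R e1 e2 e3 where "radical_complement_3 \<beta> R e1 e2 e3"
    using radical_complement_3_exists[OF assms] .
  then interpret radical_complement_3 \<beta> R e1 e2 e3 .
  have "\<not> vec.dim {\<beta> a b | a b. True} \<le> 1"
    using in_span_singleton_if_dim_le_1 values_not_in_span_singleton by metis
  then show ?thesis
    using dim_values_le_3 by auto
qed

lemma bit_vec_neg [simp]: "- (x :: bit ^ 'n) = x"
  by (simp add: vec_eq_iff)

lemma bit_vec_add_eq_0_iff: "(x :: bit ^ 'n) + y = 0 \<longleftrightarrow> x = y"
  using eq_neg_iff_add_eq_0[of x y] by simp

lemma bit_vec_add_self [simp]: "(x :: bit ^ 'n) + x = 0"
  by (simp only: bit_vec_add_eq_0_iff)

lemma alt_groupD:
  assumes "alt_group T"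
  shows "T \<subseteq> affine_group"
    and "t \<in> T \<Longrightarrow> u \<in> T \<Longrightarrow> t \<circ> u = u \<circ> t"
    and "t \<in> T \<Longrightarrow> t \<circ> t = id"
    and "\<exists>!t. t \<in> T \<and> t x = y"
  using assms unfolding alt_group_def by simp_all

lemma tau_in_group:
  assumes "alt_group T"
  shows "tau T b \<in> T" and "tau T b 0 = b"
proof -
  from alt_groupD(4)[OF assms] have "tau T b \<in> T \<and> tau T b 0 = b"
    unfolding tau_def by (rule theI')
  then show "tau T b \<in> T" and "tau T b 0 = b" by blast+
qed

lemma linear_dotp_left:
  assumes "alt_group T"
  shows "Vector_Spaces.linear (*s) (*s) (\<lambda>a. dotp T a b)"
proof -
  have "tau T b \<in> affine_group"
    using tau_in_group(1)[OF assms] alt_groupD(1)[OF assms] by blast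
  then obtain M c where Mc: "tau T b = (\<lambda>x. M *v x + c)"
    unfolding affine_group_def by blast
  then have "c = b"
    using tau_in_group(2)[OF assms, of b] by simp
  have "dotp T a b = a + M *v a + (b + c)" for a
    unfolding dotp_def circ_def Mc by (simp only: add_ac)
  then have "dotp T a b = (mat 1 + M) *v a" for a
    using \<open>c = b\<close> by (simp add: matrix_vector_mult_add_rdistrib)
  then show ?thesis
    by simp
qed

lemma circ_commute:
  assumes "alt_group T"
  shows "circ T a b = circ T b a"
proof -
  have "tau T b \<circ> tau T a = tau T a \<circ> tau T b"
    using alt_groupD(2)[OF assms] tau_in_group(1)[OF assms] by blast
  then have "tau T b (tau T a 0) = tau T a (tau T b 0)"
    by (metis comp_apply)
  then show ?thesis
    unfolding circ_def tau_in_group(2)[OF assms] .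
qed

lemma circ_self:
  assumes "alt_group T"
  shows "circ T a a = 0"
proof -
  have "tau T a \<circ> tau T a = id"
    using alt_groupD(3)[OF assms] tau_in_group(1)[OF assms] by blast
  then have "tau T a (tau T a 0) = 0"
    by (metis comp_apply id_apply)
  then show ?thesis
    unfolding circ_def tau_in_group(2)[OF assms] .
qed

lemma alternating_bilinear_dotp:
  assumes "alt_group T"
  shows "alternating_bilinear (dotp T)"
  unfolding alternating_bilinear_def
proof (intro conjI allI)
  show "Vector_Spaces.linear (*s) (*s) (\<lambda>a. dotp T a b)" for b
    using linear_dotp_left[OF assms] .
  have "dotp T b = (\<lambda>a. dotp T a b)" for b
    unfolding dotp_def using circ_commute[OF assms] by (simp add: fun_eq_iff add_ac)
  then show "Vector_Spaces.linear (*s) (*s) (dotp T b)" for b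
    using linear_dotp_left[OF assms] by metis
  show "dotp T a a = 0" for a
    by (simp add: dotp_def circ_self[OF assms])
qed

lemma weak_keys_eq_radical: "weak_keys T = bilinear_radical (dotp T)"
  unfolding weak_keys_def bilinear_radical_def dotp_def bit_vec_add_eq_0_iff
  by (metis add.commute)

theorem proposition5:
  fixes T :: "((bit ^ 'n::finite) \<Rightarrow> (bit ^ 'n)) set"
  assumes "alt_group T"
    and "int (vec.dim (weak_keys T)) = int CARD('n) - 3"
  shows "vec.dim (error_space T) \<in> {2, 3}"
proof -
  have "vec.dim (bilinear_radical (dotp T)) + 3 = CARD('n)"
    using assms(2) unfolding weak_keys_eq_radical by linarith
  then show ?thesis
    unfolding error_space_def
    by (rule dim_values_if_radical_codim_3[OF alternating_bilinear_dotp[OF assms(1)]])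
qed

end
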